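(* The set $(8,\underbrace{4,\dots,4}_{8},\underbrace{0,\dots,0}_{7})^{B_{16}}$ of all vectors in $\mathbb{R}^{16}$ obtained from $(8,4,4,4,4,4,4,4,4,0,0,0,0,0,0,0)$ by permuting coordinates and changing signs of coordinates (this is $(8\sqrt3\,v_{2,8})^{B_{16}}$) is contained in a single shell of the Barnes–Wall lattice $BW_{16}$, i.e. in $\{x\in BW_{16} : \|x\|^2=m\}$ for some $m$.
   Context: Here $v_{2,8}=12^{-1/2}(2,1^8,0^7)\in\mathbb{R}^{16}$ and $B_{16}$ is the group of coordinate permutations and sign changes. The Barnes–Wall lattice $BW_{16}\subset\mathbb{R}^{16}$ is the set of integer linear combinations of the rows of the $16\times16$ matrix whose rows are: (4,0,0,0,0,0,0,0,0,0,0,0,0,0,0,0), (4,4,0,0,0,0,0,0,0,0,0,0,0,0,0,0), (4,0,4,0,0,0,0,0,0,0,0,0,0,0,0,0), (2,2,2,2,0,0,0,0,0,0,0,0,0,0,0,0), (4,0,0,0,4,0,0,0,0,0,0,0,0,0,0,0), (2,2,0,0,2,2,0,0,0,0,0,0,0,0,0,0), (2,0,2,0,2,0,2,0,0,0,0,0,0,0,0,0), (2,2,2,2,2,2,2,2,0,0,0,0,0,0,0,0), (4,0,0,0,0,0,0,0,4,0,0,0,0,0,0,0), (2,2,0,0,0,0,0,0,2,2,0,0,0,0,0,0), (2,0,2,0,0,0,0,0,2,0,2,0,0,0,0,0), (2,2,2,2,0,0,0,0,2,2,2,2,0,0,0,0), (2,0,0,0,2,0,0,0,2,0,0,0,2,0,0,0),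 (2,2,0,0,2,2,0,0,2,2,0,0,2,2,0,0), (2,0,2,0,2,0,2,0,2,0,2,0,2,0,2,0), (1,1,1,1,1,1,1,1,1,1,1,1,1,1,1,1). A shell of a lattice is the set of its vectors of a fixed squared norm. *)

theory Defs
  imports "HOL-Analysis.Analysis"
begin

text \<open>
  The library function \<open>vector\<close> places the entries of a list at the indices
  \<open>1, 2, \<dots>, 16\<close> of the cyclic index type \<open>16\<close> (where \<open>16 = 0\<close>), so a list of length 16
  is read off in order and every index is hit exactly once.
\<close>

definition BW16_matrix :: "real ^ 16 ^ 16" where
  "BW16_matrix = vector
    [vector [4, 0, 0, 0, 0, 0, 0, 0, 0, 0, 0, 0, 0, 0, 0, 0],
     vector [4, 4, 0, 0, 0, 0, 0, 0, 0, 0, 0, 0, 0, 0, 0, 0],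
     vector [4, 0, 4, 0, 0, 0, 0, 0, 0, 0, 0, 0, 0, 0, 0, 0],
     vector [2, 2, 2, 2, 0, 0, 0, 0, 0, 0, 0, 0, 0, 0, 0, 0],
     vector [4, 0, 0, 0, 4, 0, 0, 0, 0, 0, 0, 0, 0, 0, 0, 0],
     vector [2, 2, 0, 0, 2, 2, 0, 0, 0, 0, 0, 0, 0, 0, 0, 0],
     vector [2, 0, 2, 0, 2, 0, 2, 0, 0, 0, 0, 0, 0, 0, 0, 0],
     vector [2, 2, 2, 2, 2, 2, 2, 2, 0, 0, 0, 0, 0, 0, 0, 0],
     vector [4, 0, 0, 0, 0, 0, 0, 0, 4, 0, 0, 0, 0, 0, 0, 0],
     vector [2, 2, 0, 0, 0, 0, 0, 0, 2, 2, 0, 0, 0, 0, 0, 0],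
     vector [2, 0, 2, 0, 0, 0, 0, 0, 2, 0, 2, 0, 0, 0, 0, 0],
     vector [2, 2, 2, 2, 0, 0, 0, 0, 2, 2, 2, 2, 0, 0, 0, 0],
     vector [2, 0, 0, 0, 2, 0, 0, 0, 2, 0, 0, 0, 2, 0, 0, 0],
     vector [2, 2, 0, 0, 2, 2, 0, 0, 2, 2, 0, 0, 2, 2, 0, 0],
     vector [2, 0, 2, 0, 2, 0, 2, 0, 2, 0, 2, 0, 2, 0, 2, 0],
     vector [1, 1, 1, 1, 1, 1, 1, 1, 1, 1, 1, 1, 1, 1, 1, 1]]"

definition BW16 :: "(real ^ 16) set" where
  "BW16 = {x. \<exists>c :: 16 \<Rightarrow> int. x = (\<Sum>i\<in>UNIV. of_int (c i) *\<^sub>R row i BW16_matrix)}"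

definition shell :: "(real ^ 'n) set \<Rightarrow> real \<Rightarrow> (real ^ 'n) set" where
  "shell L m = {x \<in> L. (norm x)\<^sup>2 = m}"

text \<open>The group \<open>B\<^sub>n\<close>, as a set of maps of \<open>\<real>\<^sup>n\<close>; here \<open>n = CARD('n)\<close>.\<close>

definition signed_perms :: "(real ^ 'n \<Rightarrow> real ^ 'n) set" where
  "signed_perms = {g. \<exists>p s. p permutes (UNIV :: 'n set) \<and> (\<forall>i. s i \<in> {1, - 1}) \<and>
                            g = (\<lambda>x. \<chi> i. s i * x $ p i)}"

definition B_orbit :: "real ^ 'n \<Rightarrow> (real ^ 'n) set" where
  "B_orbit x = {g x | g. g \<in> signed_perms}"

definition v_2_8 :: "real ^ 16" where
  "v_2_8 = (12 powr (- 1 / 2)) *\<^sub>R vector [2, 1, 1, 1, 1, 1, 1, 1, 1, 0, 0, 0, 0, 0, 0, 0]"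

end

theory Submission
  imports Defs
begin

text \<open>
  Signed permutations preserve norms and the sublattice \<open>4\<int>\<^sup>1\<^sup>6\<close>, so it suffices that
  \<open>4\<int>\<^sup>1\<^sup>6 \<subseteq> BW16\<close>. The generator matrix is lower triangular, and a suitable integer multiple
  of each row has all its entries in \<open>{0, 4}\<close> and diagonal entry \<open>4\<close>; forward substitution
  therefore puts \<open>4e\<^sub>1, \<dots>, 4e\<^sub>1\<^sub>6\<close> into the lattice.
\<close>

text \<open>This is the fold inside \<open>vector\<close>, with a general start index
  \<open>a\<close> so that induction on the list goes through. The head is written last, at index
  \<open>a\<close>, and would hide a tail entry only if the indices wrapped around.\<close>

lemma foldr_upd_nth:
  fixes a :: "'n::{finite,comm_ring_1}"
  assumes "CHAR('n) = CARD('n)" "length xs \<le> CARD('n)" "k < length xs"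
  shows "foldr (\<lambda>x f n. fun_upd (f (n + 1)) n x) xs (\<lambda>n x. 0) a (a + of_nat k) = xs ! k"
  using assms(2,3)
proof (induction xs arbitrary: a k)
  case (Cons x xs)
  show ?case
  proof (cases k)
    case (Suc l)
    \<comment> \<open>Here \<open>0 < k < CARD('n)\<close>, and \<open>CARD('n)\<close> is the
      characteristic, so it cannot divide \<open>k\<close>.\<close>
    have "of_nat k \<noteq> (0 :: 'n)"
      using Cons.prems Suc assms(1)
      by (auto simp: of_nat_eq_0_iff_char_dvd simp del: of_nat_Suc dest: dvd_imp_le)
    then have "a + of_nat k \<noteq> a" by simp
    then show ?thesis
      using Cons.IH[of l "a + 1"] Cons.prems Suc by (simp add: add.assoc)
  qed simp
qed simp

text \<open>List positions count from 0 while \<open>vector\<close> starts at index 1, hence the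
  shift; \<open>coord 15\<close> is \<open>16 = 0\<close>.\<close>

definition coord :: "nat \<Rightarrow> 16" where
  "coord k = 1 + of_nat k"

lemma vector_nth:
  fixes xs :: "'a::zero list"
  assumes "length xs \<le> 16" "k < length xs"
  shows "(vector xs :: 'a ^ 16) $ coord k = xs ! k"
  using foldr_upd_nth[of xs k "1 :: 16"] assms by (simp add: vector_def coord_def)

lemma inj_on_coord: "inj_on coord {..<16}"
proof (rule linorder_inj_onI)
  fix k l :: nat
  assume "k < l" "l \<in> {..<16}"
  then have "of_nat (l - k) \<noteq> (0 :: 16)"
    by (auto simp: of_nat_eq_0_iff_char_dvd simp del: of_nat_diff dest: dvd_imp_le)
  with \<open>k < l\<close> show "coord k \<noteq> coord l"
    by (simp add: coord_def of_nat_diff)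
qed auto

lemma bij_betw_coord: "bij_betw coord {..<16} UNIV"
proof -
  have "card (coord ` {..<16}) = CARD(16)"
    using inj_on_coord by (simp add: card_image)
  then have "coord ` {..<16} = UNIV"
    by (intro card_subset_eq) auto
  with inj_on_coord show ?thesis by (simp add: bij_betw_def)
qed

text \<open>Replaces the cyclic index type by positions in \<open>nat\<close>, where a bounded
  quantifier can be unfolded into sixteen explicit cases.\<close>

lemma all_coord: "(\<forall>i. P i) \<longleftrightarrow> (\<forall>k\<in>{..<16}. P (coord k))"
  using bij_betw_coord unfolding bij_betw_def by (metis UNIV_I imageE)

lemma BW16_rows_triangular:
  assumes "k < 16"
  obtains d :: int where
    "\<And>j. j < 16 \<Longrightarrow> of_int d * BW16_matrix $ coord k $ coord j
              \<in> (if j < k then {0, 4} else if j = k then {4} else {0})"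
proof -
  \<comment> \<open>The nonzero entries of a row are all equal, to 4, 2 or 1; \<open>ds ! k\<close>
    is 4 divided by that common value.\<close>
  define ds :: "int list" where "ds = [1, 1, 1, 2, 1, 2, 2, 2, 1, 2, 2, 2, 2, 2, 2, 4]"
  have "\<forall>k\<in>{..<16}. \<forall>j\<in>{..<16}. of_int (ds ! k) * BW16_matrix $ coord k $ coord j
          \<in> (if j < k then {0, 4} else if j = k then {4} else {0})"
    unfolding BW16_matrix_def ds_def
    by (simp add: vector_nth lessThan_nat_numeral lessThan_Suc)
  then show ?thesis using assms that[of "ds ! k"] by simp
qed

lemma row_in_BW16: "row i BW16_matrix \<in> BW16"
proof -
  have "(\<Sum>j\<in>UNIV. of_int (if j = i then 1 else 0) *\<^sub>R row j BW16_matrix)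
      = (\<Sum>j\<in>UNIV. if j = i then row j BW16_matrix else 0)"
    by (rule sum.cong) auto
  then have "row i BW16_matrix =
      (\<Sum>j\<in>UNIV. of_int (if j = i then 1 else 0) *\<^sub>R row j BW16_matrix)"
    by simp
  then show ?thesis unfolding BW16_def by (intro CollectI exI)
qed

lemma add_in_BW16:
  assumes "x \<in> BW16" "y \<in> BW16"
  shows "x + y \<in> BW16"
proof -
  obtain b c :: "16 \<Rightarrow> int" where
    "x = (\<Sum>i\<in>UNIV. of_int (b i) *\<^sub>R row i BW16_matrix)"
    "y = (\<Sum>i\<in>UNIV. of_int (c i) *\<^sub>R row i BW16_matrix)"
    using assms unfolding BW16_def by blast
  then have "x + y = (\<Sum>i\<in>UNIV. of_int (b i + c i) *\<^sub>R row i BW16_matrix)"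
    by (simp add: scaleR_add_left sum.distrib)
  then show ?thesis unfolding BW16_def by (intro CollectI exI)
qed

lemma scale_in_BW16:
  assumes "x \<in> BW16"
  shows "of_int z *\<^sub>R x \<in> BW16"
proof -
  obtain c :: "16 \<Rightarrow> int" where "x = (\<Sum>i\<in>UNIV. of_int (c i) *\<^sub>R row i BW16_matrix)"
    using assms unfolding BW16_def by blast
  then have "of_int z *\<^sub>R x = (\<Sum>i\<in>UNIV. of_int (z * c i) *\<^sub>R row i BW16_matrix)"
    by (simp add: scaleR_sum_right)
  then show ?thesis unfolding BW16_def by (intro CollectI exI)
qed

lemma diff_in_BW16: "x - y \<in> BW16" if "x \<in> BW16" "y \<in> BW16"
  using add_in_BW16[OF that(1) scale_in_BW16[OF that(2), of "- 1"]] by simp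

lemma sum_in_BW16: "sum f A \<in> BW16" if "\<And>i. i \<in> A \<Longrightarrow> f i \<in> BW16"
proof -
  \<comment> \<open>Zero is the sum over the empty set and, by convention, over an infinite
    one.\<close>
  have "0 \<in> BW16" using scale_in_BW16[OF row_in_BW16, of 0] by simp
  with that show ?thesis
    by (induction A rule: infinite_finite_induct) (auto intro: add_in_BW16)
qed

lemma axis_four_in_BW16:
  assumes "k < 16"
  shows "axis (coord k) 4 \<in> BW16"
  using assms
proof (induction k rule: less_induct)
  case (less k)
  obtain d :: int where d: "\<And>j. j < 16 \<Longrightarrow> of_int d * BW16_matrix $ coord k $ coord j
      \<in> (if j < k then {0, 4} else if j = k then {4} else {0})"
    using BW16_rows_triangular less.prems by blast
  \<comment> \<open>The scaled row is 4 exactly on \<open>S\<close> and at \<open>k\<close>.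
    Subtracting the axis vectors for \<open>S\<close>, which lie in the lattice by induction, leaves
    \<open>axis (coord k) 4\<close>.\<close>
  define S where "S = {j\<in>{..<k}. of_int d * BW16_matrix $ coord k $ coord j = 4}"
  have ax: "axis (coord j) (4 :: real) $ coord l = (if j = l then 4 else 0)"
    if "j < 16" "l < 16" for j l
    using that inj_on_coord by (auto simp: axis_def inj_on_def)
  have "axis (coord k) 4 $ coord l =
      (of_int d *\<^sub>R row (coord k) BW16_matrix - (\<Sum>j\<in>S. axis (coord j) 4)) $ coord l"
    if l: "l < 16" for l
  proof -
    have "(\<Sum>j\<in>S. axis (coord j) (4 :: real) $ coord l) = (\<Sum>j\<in>S. if j = l then 4 else 0)"
      using l less.prems by (intro sum.cong) (auto simp: S_def ax)
    also have "\<dots> = (if l \<in> S then 4 else 0)"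
      by (simp add: S_def)
    finally show ?thesis
      using d[OF l] l less.prems by (auto simp: ax row_def S_def split: if_splits)
  qed
  then have "axis (coord k) 4 =
      of_int d *\<^sub>R row (coord k) BW16_matrix - (\<Sum>j\<in>S. axis (coord j) 4)"
    by (simp add: vec_eq_iff all_coord)
  also have "\<dots> \<in> BW16"
    using less by (intro diff_in_BW16 scale_in_BW16 row_in_BW16 sum_in_BW16) (auto simp: S_def)
  finally show ?case .
qed

lemma four_int_in_BW16:
  fixes x :: "real ^ 16"
  assumes "\<And>i. x $ i \<in> range (\<lambda>z. 4 * of_int z)"
  shows "x \<in> BW16"
proof -
  obtain z where z: "\<And>i. x $ i = 4 * of_int (z i)"
    using assms unfolding image_iff by metis
  have "x = (\<Sum>i\<in>UNIV. of_int (z i) *\<^sub>R axis i 4)"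
    by (simp add: vec_eq_iff axis_def z if_distrib cong: if_cong)
  moreover have "\<forall>i. axis i 4 \<in> BW16"
    by (simp add: all_coord axis_four_in_BW16)
  ultimately show ?thesis
    by (simp add: sum_in_BW16 scale_in_BW16)
qed

lemma norm_signed_perm:
  fixes x :: "real ^ 'n"
  assumes "g \<in> signed_perms"
  shows "norm (g x) = norm x"
proof -
  obtain p s where p: "p permutes (UNIV :: 'n set)" and s: "\<And>i. s i \<in> {1, - 1}"
    and g: "g = (\<lambda>x. \<chi> i. s i * x $ p i)"
    using assms unfolding signed_perms_def by blast
  have "(s i * x $ p i)\<^sup>2 = (x $ p i)\<^sup>2" for i
    using s[of i] by auto
  then have "(\<Sum>i\<in>UNIV. (g x $ i)\<^sup>2) = (\<Sum>i\<in>UNIV. (x $ p i)\<^sup>2)"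
    by (simp add: g)
  also have "\<dots> = (\<Sum>i\<in>UNIV. (x $ i)\<^sup>2)"
    using sum.permute[OF p, of "\<lambda>i. (x $ i)\<^sup>2"] by (simp add: o_def)
  finally show ?thesis
    by (simp add: norm_vec_def L2_set_def)
qed

theorem theorem7p4:
  "B_orbit (vector [8, 4, 4, 4, 4, 4, 4, 4, 4, 0, 0, 0, 0, 0, 0, 0] :: real ^ 16)
      = B_orbit ((8 * sqrt 3) *\<^sub>R v_2_8)
   \<and> (\<exists>m. B_orbit (vector [8, 4, 4, 4, 4, 4, 4, 4, 4, 0, 0, 0, 0, 0, 0, 0] :: real ^ 16)
             \<subseteq> shell BW16 m)"
proof -
  define w :: "real ^ 16" where
    "w = vector [8, 4, 4, 4, 4, 4, 4, 4, 4, 0, 0, 0, 0, 0, 0, 0]"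
  \<comment> \<open>\<open>u\<close> is \<open>w / 4\<close> over the integers: it supplies the
    witnesses that all entries of \<open>w\<close> are multiples of 4.\<close>
  define u :: "int ^ 16" where
    "u = vector [2, 1, 1, 1, 1, 1, 1, 1, 1, 0, 0, 0, 0, 0, 0, 0]"
  \<comment> \<open>The scalar 8 \<open>sqrt 3\<close> divided by \<open>sqrt 12\<close> is thus
    exactly 4.\<close>
  have "sqrt 12 = 2 * sqrt 3"
    using real_sqrt_mult[of 4 3] by simp
  then have "8 * sqrt 3 * 12 powr (- 1 / 2) = 4"
    by (simp add: powr_minus powr_half_sqrt field_simps)
  then have "(8 * sqrt 3) *\<^sub>R v_2_8 =
      4 *\<^sub>R (vector [2, 1, 1, 1, 1, 1, 1, 1, 1, 0, 0, 0, 0, 0, 0, 0] :: real ^ 16)"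
    by (simp add: v_2_8_def)
  moreover have "\<forall>i. w $ i =
      (4 *\<^sub>R (vector [2, 1, 1, 1, 1, 1, 1, 1, 1, 0, 0, 0, 0, 0, 0, 0] :: real ^ 16)) $ i"
    unfolding all_coord w_def
    by (simp add: vector_nth lessThan_nat_numeral lessThan_Suc)
  ultimately have w: "w = (8 * sqrt 3) *\<^sub>R v_2_8"
    by (simp add: vec_eq_iff)
  have wu: "\<forall>i. w $ i = 4 * of_int (u $ i)"
    unfolding all_coord w_def u_def
    by (simp add: vector_nth lessThan_nat_numeral lessThan_Suc)
  \<comment> \<open>The shell is that of \<open>w\<close> itself, of squared norm 64 + 8 * 16 = 192;
    this value need not be computed.\<close>
  have "g w \<in> shell BW16 ((norm w)\<^sup>2)" if g: "g \<in> signed_perms" for g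
  proof -
    have "g w $ i \<in> range (\<lambda>z. 4 * of_int z)" for i
    proof -
      obtain p s where s: "\<forall>i. s i \<in> {1, - 1}" and "g = (\<lambda>x. \<chi> i. s i * x $ p i)"
        using g unfolding signed_perms_def by blast
      then have "g w $ i = w $ p i \<or> g w $ i = - (w $ p i)"
        using s[rule_format, of i] by auto
      then have "g w $ i = 4 * of_int (u $ p i) \<or> g w $ i = 4 * of_int (- u $ p i)"
        by (simp add: wu)
      then show ?thesis by blast
    qed
    then show ?thesis
      by (simp add: shell_def four_int_in_BW16 norm_signed_perm[OF g])
  qed
  then have "B_orbit w \<subseteq> shell BW16 ((norm w)\<^sup>2)"
    unfolding B_orbit_def by blast
  with w show ?thesis unfolding w_def by auto
qed

end
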